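(* Let $k\ge 1$ and $n=p_1\cdots p_k$ with $p_1<\cdots<p_k$ odd primes. Then $g(\Phi_n)\ge\varepsilon^+(n)$ and $g(\Psi_n)\ge\varepsilon^-(n)$, where \[ \varepsilon^{+}(n)=\max_{\substack{A\uplus B=\underline{n}\setminus\{n\}\\ A\ne\emptyset\\ \mathcal{C}^{+}(B)}}\Bigl(\min A-\sum_{d\in B}\mu(n/d)\,d\Bigr),\qquad \varepsilon^{-}(n)=\max_{\substack{A\uplus B=\underline{n}\setminus\{n\}\\ A\ne\emptyset\\ \mathcal{C}^{-}(B)}}\Bigl(\min A+\sum_{d\in B}\mu(n/d)\,d\Bigr), \] the maxima ranging over all partitions of $\underline{n}\setminus\{n\}$ into disjoint sets $A,B$ with $A$ nonempty and $B$ satisfying the stated condition.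
   Context: $\Phi_n$ and $\Psi_n$ are the $n$-th cyclotomic and inverse cyclotomic polynomials: $\Phi_n(x)=\prod_{1\le j\le n,\gcd(j,n)=1}(x-e^{2\pi ij/n})$, $\Psi_n(x)=\prod_{1\le j\le n,\gcd(j,n)\ne1}(x-e^{2\pi ij/n})$. For a polynomial $f=c_1x^{\nu_1}+\cdots+c_tx^{\nu_t}$ with all $c_i\ne0$, $0\le\nu_1<\cdots<\nu_t$, $g(f)=\max_{1\le i<t}(\nu_{i+1}-\nu_i)$ if $t\ne1$ and $g(f)=0$ if $t=1$. For square-free $d$, $\mu(d)=(-1)^{\omega(d)}$ with $\omega(d)$ the number of prime factors. Notation: for a positive integer $d$, $\overline{d}=\{h: d\mid h\}$ and $\underline{d}=\{h: h\mid d\}$ (positive integers); for a set $B$ of positive integers, $\underline{B}=\bigcup_{d\in B}\underline{d}$ and $B^{\pm}=\{d\in B:\mu(n/d)=\pm1\}$. The condition $\mathcal{C}^{\pm}(B)$ means: for all $d\in\underline{B}$, $\#(B^{\pm}\cap\overline{d})\ge\#(B^{\mp}\cap\overline{d})$ (so $\mathcal{C}^+(B)$: $\#(B^+\cap\overline d)\ge\#(B^-\cap\overline d)$; $\mathcal{C}^-(B)$: $\#(B^-\cap\overline d)\ge\#(B^+\cap\overline d)$). *)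

theory Defs
  imports
    Complex_Main
    "HOL-Computational_Algebra.Computational_Algebra"
begin

definition cyclotomic :: "nat \<Rightarrow> complex poly" where
  "cyclotomic n =
     (\<Prod>j | 1 \<le> j \<and> j \<le> n \<and> gcd j n = 1.
        [:- exp (2 * complex_of_real pi * \<i> * of_nat j / of_nat n), 1:])"

definition inverse_cyclotomic :: "nat \<Rightarrow> complex poly" where
  "inverse_cyclotomic n =
     (\<Prod>j | 1 \<le> j \<and> j \<le> n \<and> gcd j n \<noteq> 1.
        [:- exp (2 * complex_of_real pi * \<i> * of_nat j / of_nat n), 1:])"

definition exponents :: "'a::zero poly \<Rightarrow> nat list" where
  "exponents f = sorted_list_of_set {i. coeff f i \<noteq> 0}"

(* The list of exponents is strictly increasing, so the subtraction on nat never truncates.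
   The zero polynomial, which has no exponents, is given the value 0. *)
definition max_gap :: "'a::zero poly \<Rightarrow> nat" where
  "max_gap f =
     (let \<nu> = exponents f in
      if length \<nu> \<le> 1 then 0
      else Max {\<nu> ! Suc i - \<nu> ! i | i. Suc i < length \<nu>})"

definition mu :: "nat \<Rightarrow> int" where
  "mu d = (if squarefree d then (- 1) ^ card (prime_factors d) else 0)"

definition multiples_of :: "nat \<Rightarrow> nat set" where
  "multiples_of d = {h. 0 < h \<and> d dvd h}"

definition divisors_of :: "nat \<Rightarrow> nat set" where
  "divisors_of d = {h. 0 < h \<and> h dvd d}"

definition divisor_closure :: "nat set \<Rightarrow> nat set" where
  "divisor_closure B = (\<Union>d\<in>B. divisors_of d)"

definition plus_part :: "nat \<Rightarrow> nat set \<Rightarrow> nat set" where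
  "plus_part n B = {d \<in> B. mu (n div d) = 1}"

definition minus_part :: "nat \<Rightarrow> nat set \<Rightarrow> nat set" where
  "minus_part n B = {d \<in> B. mu (n div d) = - 1}"

definition cond_plus :: "nat \<Rightarrow> nat set \<Rightarrow> bool" where
  "cond_plus n B \<longleftrightarrow>
     (\<forall>d\<in>divisor_closure B.
        card (plus_part n B \<inter> multiples_of d) \<ge> card (minus_part n B \<inter> multiples_of d))"

definition cond_minus :: "nat \<Rightarrow> nat set \<Rightarrow> bool" where
  "cond_minus n B \<longleftrightarrow>
     (\<forall>d\<in>divisor_closure B.
        card (minus_part n B \<inter> multiples_of d) \<ge> card (plus_part n B \<inter> multiples_of d))"

(* For n > 1 the maxima below are over finite nonempty sets: the empty set B is always admissible.
   They are integer-valued because individual partitions can contribute negative values. *)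
definition eps_plus :: "nat \<Rightarrow> int" where
  "eps_plus n =
     Max {int (Min A) - (\<Sum>d\<in>B. mu (n div d) * int d) | A B.
            A \<union> B = divisors_of n - {n} \<and> A \<inter> B = {} \<and> A \<noteq> {} \<and> cond_plus n B}"

definition eps_minus :: "nat \<Rightarrow> int" where
  "eps_minus n =
     Max {int (Min A) + (\<Sum>d\<in>B. mu (n div d) * int d) | A B.
            A \<union> B = divisors_of n - {n} \<and> A \<inter> B = {} \<and> A \<noteq> {} \<and> cond_minus n B}"

end

theory Submission
  imports Defs
begin

text \<open>
  One has $\Phi_n = \prod_{d \mid n} (x^d - 1)^{\mu(n/d)}$, and $\Psi_n$ is the product over the
  proper divisors with the exponents negated. The condition on $B$ says that no root of unity is a
  pole of the subproduct $G$ over $B$, so $G$ is a polynomial; its degree is the signed sum of the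
  elements of $B$. The remaining factors are $-1$ modulo $x^{\min A}$, so the whole polynomial
  agrees with $\pm G$ below $x^{\min A}$. It is not equal to $\pm G$, because a primitive root of
  unity of order the largest remaining index occurs in exactly one remaining factor. Hence it has a
  term of degree at least $\min A$, and there is a gap from $\deg G$ to the next exponent.
\<close>

section \<open>Gaps between exponents\<close>

lemma max_gap_ge:
  assumes "coeff F i \<noteq> 0" "coeff F j \<noteq> 0" "i < j" "\<And>l. i < l \<Longrightarrow> l < j \<Longrightarrow> coeff F l = 0"
  shows "j - i \<le> max_gap F"
proof -
  define S where "S = {l. coeff F l \<noteq> 0}"
  define xs where "xs = exponents F"
  have fin: "finite S"
    using MOST_coeff_eq_0[of F] by (simp add: S_def MOST_iff_cofinite)
  have xs: "xs = sorted_list_of_set S"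
    by (simp add: xs_def exponents_def S_def)
  have set_xs: "set xs = S" and sorted: "sorted_wrt (<) xs"
    using fin by (auto simp: xs)
  from set_xs assms obtain s t where s: "s < length xs" "xs ! s = i" and t: "t < length xs" "xs ! t = j"
    by (metis (mono_tags, lifting) S_def in_set_conv_nth mem_Collect_eq)
  have mono: "xs ! u < xs ! v" if "u < v" "v < length xs" for u v
    using sorted that by (simp add: sorted_wrt_iff_nth_less)
  have "s < t"
    using mono[of t s] s t \<open>i < j\<close> by (cases s t rule: linorder_cases) auto
  have "t = Suc s"
  \<comment> \<open>Otherwise the entry after position \<open>s\<close> would be an exponent
    strictly between \<open>i\<close> and \<open>j\<close>.\<close>
  proof (rule ccontr)
    assume "t \<noteq> Suc s"
    with \<open>s < t\<close> have "Suc s < t" by simp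
    hence "i < xs ! Suc s" "xs ! Suc s < j" using mono[of s "Suc s"] mono[of "Suc s" t] s t by auto
    moreover have "xs ! Suc s \<in> S" using set_xs \<open>Suc s < t\<close> t by (metis less_trans nth_mem)
    ultimately show False using assms(4) by (auto simp: S_def)
  qed
  hence "j - i \<in> {xs ! Suc u - xs ! u | u. Suc u < length xs}" using s t by blast
  moreover have "finite {xs ! Suc u - xs ! u | u. Suc u < length xs}"
    by (rule finite_surj[of "{..<length xs}" _ "\<lambda>u. xs ! Suc u - xs ! u"]) auto
  ultimately have "j - i \<le> Max {xs ! Suc u - xs ! u | u. Suc u < length xs}" by (intro Max_ge)
  thus ?thesis using \<open>t = Suc s\<close> t by (simp add: max_gap_def xs_def Let_def)
qed

text \<open>Below \<open>a\<close> the last exponent of \<open>F\<close> is that of the leading term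
  of \<open>G\<close>, and since \<open>F\<close> differs from \<open>smult c G\<close> there must
  be another exponent at or above \<open>a\<close>. If \<open>degree G \<ge> a\<close>, truncated
  subtraction makes the bound trivial.\<close>

lemma max_gap_ge_of_agree_below:
  fixes F G :: "'a::idom poly"
  assumes "c \<noteq> 0" "\<And>i. i < a \<Longrightarrow> coeff F i = c * coeff G i"
    and "G \<noteq> 0" "F \<noteq> smult c G"
  shows "a - degree G \<le> max_gap F"
proof (cases "degree G < a")
  case True
  have "\<exists>j\<ge>a. coeff F j \<noteq> 0"
  proof (rule ccontr)
    assume *: "\<not> ?thesis"
    have "F = smult c G"
    proof (rule poly_eqI)
      fix i show "coeff F i = coeff (smult c G) i"
        using * assms(2)[of i] True coeff_eq_0[of G i] by (cases "i < a") auto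
    qed
    with assms show False by simp
  qed
  then obtain j0 where j0: "j0 \<ge> a \<and> coeff F j0 \<noteq> 0" by blast
  define j where "j = (LEAST j. j \<ge> a \<and> coeff F j \<noteq> 0)"
  have j: "j \<ge> a \<and> coeff F j \<noteq> 0"
    unfolding j_def by (rule LeastI, rule j0)
  \<comment> \<open>Between \<open>degree G\<close> and \<open>j\<close> nothing occurs: up to
    \<open>a\<close> because the coefficients of \<open>G\<close> vanish, from \<open>a\<close> on
    by minimality of \<open>j\<close>.\<close>
  have "j - degree G \<le> max_gap F"
  proof (rule max_gap_ge)
    show "coeff F (degree G) \<noteq> 0" using assms True by simp
    show "coeff F j \<noteq> 0" "degree G < j" using j True by auto
    fix l assume l: "degree G < l" "l < j"
    show "coeff F l = 0"
    proof (cases "l < a")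
      case True
      thus ?thesis using assms(2) l coeff_eq_0[of G l] by simp
    next
      case False
      thus ?thesis using l not_less_Least[of l "\<lambda>j. j \<ge> a \<and> coeff F j \<noteq> 0"] by (auto simp: j_def)
    qed
  qed
  thus ?thesis using j by linarith
qed simp

section \<open>Complex polynomials and their root multisets\<close>

text \<open>Over the complex numbers both polynomials split into linear factors, so a sub-multiset
  of roots gives a subproduct, up to nonzero constants.\<close>

lemma dvd_if_proots_subset:
  fixes p q :: "complex poly"
  assumes "proots p \<subseteq># proots q" "p \<noteq> 0"
  shows "p dvd q"
proof -
  have "(\<Prod>x\<in>#proots p. [:-x, 1:]) dvd (\<Prod>x\<in>#proots q. [:-x, 1:])"
    using assms(1) by (intro prod_mset_subset_imp_dvd image_mset_subseteq_mono)
  hence "p dvd smult (lead_coeff q) (\<Prod>x\<in>#proots q. [:-x, 1:])"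
    by (subst complex_poly_decompose_multiset[of p, symmetric])
       (use assms(2) in \<open>simp add: smult_dvd_iff dvd_smult\<close>)
  thus ?thesis by (simp add: complex_poly_decompose_multiset)
qed

lemma monic_eq_if_proots_eq:
  fixes p q :: "complex poly"
  assumes "proots p = proots q" "lead_coeff p = 1" "lead_coeff q = 1"
  shows "p = q"
  using complex_poly_decompose_multiset[of p] complex_poly_decompose_multiset[of q] assms
  by simp

section \<open>The polynomials x^d - 1 and their products\<close>

definition unity_poly :: "nat \<Rightarrow> complex poly" where
  "unity_poly d = monom 1 d - 1"

lemma poly_unity_poly [simp]: "poly (unity_poly d) z = z ^ d - 1"
  by (simp add: unity_poly_def poly_monom)

lemma degree_unity_poly [simp]: "degree (unity_poly d) = d"
proof (cases "d = 0")
  case False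
  hence "degree (monom 1 d + (- 1 :: complex poly)) = degree (monom (1::complex) d)"
    by (intro degree_add_eq_left) (simp add: degree_monom_eq)
  thus ?thesis by (simp add: unity_poly_def degree_monom_eq)
qed (simp add: unity_poly_def one_pCons monom_0)

lemma lead_coeff_unity_poly [simp]: "d > 0 \<Longrightarrow> coeff (unity_poly d) d = 1"
  by (simp add: unity_poly_def coeff_eq_0)

lemma unity_poly_neq_0 [simp]: "d > 0 \<Longrightarrow> unity_poly d \<noteq> 0"
  by (metis lead_coeff_unity_poly coeff_0 zero_neq_one)

text \<open>All roots are simple: the derivative d x^(d-1) has no root in common with x^d -
  1.\<close>

lemma count_proots_unity_poly:
  assumes "d > 0"
  shows "count (proots (unity_poly d)) z = (if z ^ d = 1 then 1 else 0)"
proof -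
  have "rsquarefree (unity_poly d)"
    unfolding rsquarefree_roots
  proof (intro allI notI)
    fix a assume "poly (unity_poly d) a = 0 \<and> poly (pderiv (unity_poly d)) a = 0"
    hence "a ^ d = 1" "a ^ (d - 1) = 0"
      using assms by (auto simp: unity_poly_def pderiv_diff pderiv_monom poly_monom)
    thus False using assms by (cases d) auto
  qed
  hence "order z (unity_poly d) = 1" if "z ^ d = 1"
    using that by (simp add: rsquarefree_root_order assms)
  thus ?thesis using assms by (auto simp: order_eq_0_iff)
qed

lemma prod_unity_poly_neq_0:
  "\<forall>d\<in>D. d > 0 \<Longrightarrow> (\<Prod>d\<in>D. unity_poly d) \<noteq> 0"
  \<comment> \<open>An infinite product has the default value 1.\<close>
  by (cases "finite D") auto

lemma count_proots_prod_unity_poly: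
  assumes "finite D" "\<forall>d\<in>D. d > 0"
  shows "count (proots (\<Prod>d\<in>D. unity_poly d)) z = card {d\<in>D. z ^ d = 1}"
proof -
  have "count (proots (\<Prod>d\<in>D. unity_poly d)) z = (\<Sum>d\<in>D. count (proots (unity_poly d)) z)"
    using assms by (simp add: proots_prod count_sum del: count_proots)
  also have "\<dots> = (\<Sum>d\<in>D. if z ^ d = 1 then 1 else 0)"
    using assms by (intro sum.cong refl count_proots_unity_poly) auto
  also have "\<dots> = card {d\<in>D. z ^ d = 1}"
    using assms by (simp add: sum.If_cases Int_def)
  finally show ?thesis .
qed

lemma degree_prod_unity_poly:
  "\<forall>d\<in>D. d > 0 \<Longrightarrow> degree (\<Prod>d\<in>D. unity_poly d) = \<Sum>D"
  by (subst degree_prod_sum_eq) auto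

lemma lead_coeff_prod_unity_poly:
  "\<forall>d\<in>D. d > 0 \<Longrightarrow> lead_coeff (\<Prod>d\<in>D. unity_poly d) = 1"
  by (subst lead_coeff_prod) (auto intro!: prod.neutral)

text \<open>Divisibility by \<open>monom 1 a\<close> expresses congruence modulo x^a, under which
  every factor x^d - 1 with d \<ge> a becomes -1.\<close>

lemma prod_unity_poly_cong:
  assumes "finite D" "\<forall>d\<in>D. a \<le> d"
  shows "monom 1 a dvd (\<Prod>d\<in>D. unity_poly d) - [:(-1) ^ card D:]"
  using assms
proof (induction D rule: finite_induct)
  case (insert x D)
  let ?P = "\<Prod>d\<in>D. unity_poly d" and ?c = "[:(-1) ^ card D:] :: complex poly"
  have "monom 1 a dvd (monom 1 x :: complex poly)"
    using insert.prems by (simp add: monom_1_dvd_iff' )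
  \<comment> \<open>The new factor turns \<open>?P\<close> into \<open>monom 1 x * ?P - ?P\<close>,
    and the new constant is \<open>- ?c\<close>.\<close>
  hence "monom 1 a dvd monom 1 x * ?P - (?P - ?c)"
    using insert.IH insert.prems by (intro dvd_diff dvd_mult2 insert.IH) auto
  also have "monom 1 x * ?P - (?P - ?c) = (\<Prod>d\<in>insert x D. unity_poly d) - [:(-1) ^ card (insert x D):]"
    using insert by (simp add: unity_poly_def algebra_simps)
  finally show ?case .
qed (simp add: one_pCons)

section \<open>Orders of roots of unity\<close>

text \<open>The number \<open>m\<close> is the multiplicative order of \<open>z\<close>. Through it,
  counting the factors x^d - 1 that vanish at \<open>z\<close> becomes counting the multiples
  \<open>d\<close> of \<open>m\<close>.\<close>

lemma power_eq_1_iff_dvd: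
  fixes z :: "'a::field"
  assumes "z ^ d = 1" "d > 0"
  obtains m where "m > 0" "\<And>h. z ^ h = 1 \<longleftrightarrow> m dvd h"
proof -
  define m where "m = (LEAST m. m > 0 \<and> z ^ m = 1)"
  have m: "m > 0 \<and> z ^ m = 1"
    unfolding m_def by (rule LeastI[of _ d]) (use assms in auto)
  have "z ^ h = 1 \<longleftrightarrow> m dvd h" for h
  proof -
    have "z ^ h = (z ^ m) ^ (h div m) * z ^ (h mod m)"
      by (metis mult_div_mod_eq power_add power_mult)
    hence "z ^ h = z ^ (h mod m)" using m by simp
    \<comment> \<open>The remainder is smaller than \<open>m\<close>, the least positive exponent
      giving 1.\<close>
    moreover have "z ^ (h mod m) = 1 \<longleftrightarrow> h mod m = 0"
      using not_less_Least[of "h mod m" "\<lambda>m. m > 0 \<and> z ^ m = 1"] m by (auto simp: m_def)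
    ultimately show ?thesis by (auto simp: dvd_eq_mod_eq_0)
  qed
  with m that show ?thesis by blast
qed

text \<open>Names the exponential occurring in \<open>cyclotomic\<close> and
  \<open>inverse_cyclotomic\<close>.\<close>

definition root_of_unity :: "nat \<Rightarrow> nat \<Rightarrow> complex" where
  "root_of_unity n j = exp (2 * complex_of_real pi * \<i> * of_nat j / of_nat n)"

lemma root_of_unity_power_eq_1_iff:
  assumes "n > 0"
  shows "root_of_unity n j ^ d = 1 \<longleftrightarrow> n dvd j * d"
proof -
  have "root_of_unity n j = cis (2 * pi * real j / real n)"
    by (simp add: root_of_unity_def cis_conv_exp mult_ac)
  hence "root_of_unity n j ^ d = cis (real d * (2 * pi * real j / real n))"
    by (simp add: DeMoivre)
  also have "\<dots> = 1 \<longleftrightarrow> cos (real d * (2 * pi * real j / real n)) = 1"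
    \<comment> \<open>Cosine 1 forces sine 0, so the real part alone decides.\<close>
    using sin_cos_squared_add[of "real d * (2 * pi * real j / real n)"] by (auto simp: complex_eq_iff simp del: sin_cos_squared_add)
  also have "\<dots> \<longleftrightarrow> (\<exists>i::int. real (j * d) = real_of_int i * real n)"
    using assms by (auto simp: cos_one_2pi_int field_simps)
  also have "\<dots> \<longleftrightarrow> (\<exists>i::int. int (j * d) = i * int n)"
    using of_int_eq_iff[of "int (j * d)" "_ * int n", where 'a = real]
    unfolding of_int_mult of_int_of_nat_eq by simp
  also have "\<dots> \<longleftrightarrow> n dvd j * d"
    by (metis dvd_def int_dvd_int_iff mult.commute)
  finally show ?thesis .
qed

lemma bij_betw_root_of_unity:
  assumes "n > 0"
  shows "bij_betw (root_of_unity n) {1..n} {z. z ^ n = 1}"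
proof -
  have eq: "root_of_unity n j = cis (2 * pi * real j / real n)" for j
    by (simp add: root_of_unity_def cis_conv_exp mult_ac)
  have 1: "bij_betw (root_of_unity n) {..<n} {z. z ^ n = 1}"
    using bij_betw_roots_unity[OF assms] by (simp add: eq[abs_def])
  \<comment> \<open>The known bijection starts at index 0, the cyclotomic products at 1. The indices
    0 and \<open>n\<close> give the same root 1, so they may be exchanged.\<close>
  have "bij_betw (\<lambda>j. if j = n then 0 else j) {1..n} {..<n}"
    by (rule bij_betw_byWitness[where f' = "\<lambda>j. if j = 0 then n else j"]) (use assms in auto)
  from bij_betw_trans[OF this 1]
  have "bij_betw (root_of_unity n \<circ> (\<lambda>j. if j = n then 0 else j)) {1..n} {z. z ^ n = 1}" .
  also have "?this \<longleftrightarrow> ?thesis"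
    using assms by (intro bij_betw_cong) (auto simp: root_of_unity_def)
  finally show ?thesis .
qed

lemma root_of_unity_power_eq_1_iff_coprime:
  assumes "n > 0" "gcd j n = 1"
  shows "root_of_unity n j ^ d = 1 \<longleftrightarrow> n dvd d"
  using assms by (metis coprime_commute coprime_dvd_mult_right_iff coprime_iff_gcd_eq_1 root_of_unity_power_eq_1_iff)

section \<open>Roots of cyclotomic polynomials\<close>

lemma cyclotomic_eq: "cyclotomic n = (\<Prod>j | 1 \<le> j \<and> j \<le> n \<and> gcd j n = 1. [:- root_of_unity n j, 1:])"
  by (simp add: cyclotomic_def root_of_unity_def)

lemma cyclotomic_neq_0: "cyclotomic n \<noteq> 0"
  and lead_coeff_cyclotomic: "lead_coeff (cyclotomic n) = 1"
  by (auto simp: cyclotomic_eq lead_coeff_prod simp del: coeff_pCons)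

lemma proots_prod_linear:
  assumes "finite J" "inj_on f J"
  shows "proots (\<Prod>j\<in>J. [:- f j, 1 :: 'a :: idom:]) = mset_set (f ` J)"
  using assms by (simp add: proots_prod sum_unfold_sum_mset image_mset_mset_set[symmetric] del: image_mset_mset_set)

text \<open>The two index conditions partition \<open>{1..n}\<close>, so the product runs once over
  all n-th roots of unity. Both sides are monic with these as simple roots.\<close>

lemma cyclotomic_times_inverse_cyclotomic:
  assumes "n > 0"
  shows "cyclotomic n * inverse_cyclotomic n = unity_poly n"
proof -
  have "cyclotomic n * inverse_cyclotomic n = (\<Prod>j\<in>{1..n}. [:- root_of_unity n j, 1:])"
    unfolding cyclotomic_def inverse_cyclotomic_def root_of_unity_def[symmetric]
    by (subst prod.union_disjoint[symmetric]) (auto intro!: prod.cong)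
  also have "\<dots> = unity_poly n"
  proof (rule monic_eq_if_proots_eq)
    show "proots (\<Prod>j\<in>{1..n}. [:- root_of_unity n j, 1:]) = proots (unity_poly n)"
      using bij_betw_root_of_unity[OF assms] count_proots_unity_poly[OF assms]
      by (intro multiset_eqI)
         (use assms finite_roots_unity[of n, where 'a = complex] in \<open>simp add: proots_prod_linear bij_betw_def count_mset_set' Suc_le_eq del: count_proots\<close>)
  qed (use assms in \<open>auto simp: lead_coeff_prod\<close>)
  finally show ?thesis .
qed

text \<open>The last assumption says that \<open>z\<close> has order \<open>m\<close>; the roots of
  the n-th cyclotomic polynomial are the elements of order exactly \<open>n\<close>, all
  simple.\<close>

lemma count_proots_cyclotomic:
  assumes "n > 0" "m > 0" "\<And>h. z ^ h = 1 \<longleftrightarrow> m dvd h"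
  shows "count (proots (cyclotomic n)) z = (if m = n then 1 else 0)"
proof -
  let ?J = "{j. 1 \<le> j \<and> j \<le> n \<and> gcd j n = 1}"
  have bij: "inj_on (root_of_unity n) {1..n}" "root_of_unity n ` {1..n} = {z. z ^ n = 1}"
    using bij_betw_root_of_unity[OF assms(1)] by (auto simp: bij_betw_def)
  have "inj_on (root_of_unity n) ?J"
    by (rule inj_on_subset[OF bij(1)]) auto
  moreover have fin: "finite ?J" by (rule finite_subset[of _ "{1..n}"]) auto
  ultimately have "count (proots (cyclotomic n)) z = (if z \<in> root_of_unity n ` ?J then 1 else 0)"
    unfolding cyclotomic_eq by (simp add: proots_prod_linear count_mset_set' del: count_proots)
  moreover have "z \<in> root_of_unity n ` ?J \<longleftrightarrow> m = n"
  proof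
    assume "z \<in> root_of_unity n ` ?J"
    then obtain j where j: "gcd j n = 1" "z = root_of_unity n j" by auto
    have "m dvd h \<longleftrightarrow> n dvd h" for h
      using root_of_unity_power_eq_1_iff_coprime[OF assms(1) j(1), of h] assms(3)[of h] j(2) by simp
    thus "m = n" by (meson dvd_antisym dvd_refl)
  next
    assume "m = n"
    hence "z \<in> root_of_unity n ` {1..n}" using bij assms by simp
    then obtain j where j: "j \<in> {1..n}" "z = root_of_unity n j" by auto
    \<comment> \<open>As \<open>z\<close> has order \<open>n\<close>, this makes \<open>n\<close>
      divide \<open>n div gcd j n\<close>, which is possible only if the gcd is 1.\<close>
    have "z ^ (n div gcd j n) = 1"
      unfolding j(2) root_of_unity_power_eq_1_iff[OF assms(1)]
      by (metis div_mult_swap dvd_triv_right gcd_dvd1 gcd_dvd2 div_mult_swap mult.commute)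
    hence "n dvd n div gcd j n" using assms \<open>m = n\<close> by simp
    moreover have "n div gcd j n > 0"
      using assms(1) by (simp add: div_greater_zero_iff gcd_le2_nat)
    ultimately have "n \<le> n div gcd j n" by (rule dvd_imp_le)
    hence "\<not> gcd j n > 1" using assms(1) div_less_dividend[of "gcd j n" n] by linarith
    moreover have "gcd j n > 0" using assms(1) by simp
    ultimately have "gcd j n = 1" by linarith
    thus "z \<in> root_of_unity n ` ?J" using j by auto
  qed
  ultimately show ?thesis by simp
qed

section \<open>The Moebius function on cofactors\<close>

lemma mu_cases: "squarefree d \<Longrightarrow> mu d = 1 \<or> mu d = -1"
  by (simp add: mu_def) (metis minus_one_power_iff)

lemma mu_1 [simp]: "mu (Suc 0) = 1"
  by (simp add: mu_def)

lemma mu_prime_mult: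
  assumes "prime q" "squarefree (q * d)"
  shows "mu (q * d) = - mu d"
proof -
  have d: "squarefree d" using assms(2) by (rule squarefree_multD)
  hence "d \<noteq> 0" by (intro notI) simp
  have "\<not> q dvd d"
  proof
    assume "q dvd d"
    hence "q ^ 2 dvd q * d" by (simp add: power2_eq_square)
    thus False using assms by (meson squarefreeD not_prime_unit)
  qed
  hence "prime_factors (q * d) = insert q (prime_factors d)" "q \<notin> prime_factors d"
    using \<open>d \<noteq> 0\<close> assms(1) by (auto simp: prime_factorization_mult prime_factorization_prime)
  thus ?thesis using d assms by (simp add: mu_def)
qed

text \<open>Multiplying or dividing the cofactor \<^term>\<open>n div d\<close> by a fixed prime factor of
  \<^term>\<open>n div m\<close> exchanges the two sets.\<close>

lemma card_mu_balanced:
  assumes "squarefree n" "m dvd n" "m \<noteq> n"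
  shows "card {d. d dvd n \<and> m dvd d \<and> mu (n div d) = -1} = card {d. d dvd n \<and> m dvd d \<and> mu (n div d) = 1}"
proof -
  have "n > 0" using assms(1) by (auto intro: Nat.gr0I)
  from assms obtain r where r: "n = m * r" by auto
  hence "r \<noteq> 1" using assms by auto
  then obtain q where q: "prime q" "q dvd r" using prime_factor_nat by blast
  have "m > 0" "q > 0" using r \<open>n > 0\<close> q by (auto simp: prime_gt_0_nat)
  define f where "f d = (if q dvd d div m then d div q else d * q)" for d
  have step: "f d dvd n \<and> m dvd f d \<and> mu (n div f d) = - mu (n div d) \<and> f (f d) = d"
    if d: "d dvd n" "m dvd d" for d
  proof -
    \<comment> \<open>With \<open>n = m * c * e\<close>, the map \<open>f\<close> moves the prime
      \<open>q\<close> between \<open>c\<close> and the cofactor \<open>e\<close>. As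
      \<open>c * e\<close> is squarefree and divisible by \<open>q\<close>, exactly one of them
      contains \<open>q\<close>.\<close>
    from d obtain c where c: "d = m * c" by auto
    from d obtain e where e: "n = m * c * e" using c by auto
    have pos: "c > 0" "e > 0" "d > 0" using e c \<open>n > 0\<close> by auto
    have sf: "squarefree (c * e)" using assms(1) e by (metis mult.assoc squarefree_multD(2))
    have qce: "q dvd c * e" using q r e \<open>m > 0\<close> by (simp add: mult.assoc)
    show ?thesis
    proof (cases "q dvd c")
      case True
      then obtain c' where c': "c = q * c'" by auto
      have "\<not> q dvd c'"
      proof
        assume "q dvd c'"
        hence "q ^ 2 dvd c * e" unfolding c' power2_eq_square by (simp add: mult_dvd_mono)
        thus False using sf q(1) by (meson squarefreeD not_prime_unit)
      qed
      have fd: "f d = m * c'" using \<open>m > 0\<close> \<open>q > 0\<close> by (simp add: f_def c c' mult.left_commute)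
      have "n div f d = q * e" "n div d = e"
        using pos \<open>m > 0\<close> \<open>q > 0\<close> c' unfolding fd by (simp_all add: c e mult.assoc mult.left_commute[of _ q])
      moreover have "squarefree (q * e)"
        using sf c' by (metis mult.assoc mult.left_commute squarefree_multD(2))
      ultimately have "mu (n div f d) = - mu (n div d)" using mu_prime_mult q(1) by simp
      moreover have "f (f d) = d"
        using \<open>\<not> q dvd c'\<close> \<open>m > 0\<close> unfolding fd by (simp add: f_def c c' mult_ac)
      ultimately show ?thesis using e c' by (auto simp: fd mult_ac)
    next
      case False
      hence "q dvd e" using qce q(1) by (simp add: prime_dvd_mult_iff)
      then obtain e' where e': "e = q * e'" by auto
      have fd: "f d = m * c * q" using \<open>m > 0\<close> False by (simp add: f_def c)
      have "n div f d = e'" "n div d = q * e'"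
        using pos \<open>m > 0\<close> \<open>q > 0\<close> e' unfolding fd by (simp_all add: c e mult.assoc)
      moreover have "squarefree (q * e')" using sf e' by (metis squarefree_multD(2))
      ultimately have "mu (n div f d) = - mu (n div d)" using mu_prime_mult q(1) by simp
      moreover have "f (f d) = d"
        using \<open>m > 0\<close> \<open>q > 0\<close> unfolding fd by (simp add: f_def c mult.assoc)
      ultimately show ?thesis using e e' by (auto simp: fd mult_ac)
    qed
  qed
  have "bij_betw f {d. d dvd n \<and> m dvd d \<and> mu (n div d) = -1} {d. d dvd n \<and> m dvd d \<and> mu (n div d) = 1}"
  proof (rule bij_betw_byWitness[where f' = f])
    show "\<forall>d\<in>{d. d dvd n \<and> m dvd d \<and> mu (n div d) = -1}. f (f d) = d"
      "\<forall>d\<in>{d. d dvd n \<and> m dvd d \<and> mu (n div d) = 1}. f (f d) = d"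
      using step by blast+
    show "f ` {d. d dvd n \<and> m dvd d \<and> mu (n div d) = -1} \<subseteq> {d. d dvd n \<and> m dvd d \<and> mu (n div d) = 1}"
    proof
      fix y assume "y \<in> f ` {d. d dvd n \<and> m dvd d \<and> mu (n div d) = -1}"
      then obtain d where "y = f d" "d dvd n" "m dvd d" "mu (n div d) = -1" by blast
      with step[of d] show "y \<in> {d. d dvd n \<and> m dvd d \<and> mu (n div d) = 1}" by simp
    qed
    show "f ` {d. d dvd n \<and> m dvd d \<and> mu (n div d) = 1} \<subseteq> {d. d dvd n \<and> m dvd d \<and> mu (n div d) = -1}"
    proof
      fix y assume "y \<in> f ` {d. d dvd n \<and> m dvd d \<and> mu (n div d) = 1}"
      then obtain d where "y = f d" "d dvd n" "m dvd d" "mu (n div d) = 1" by blast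
      with step[of d] show "y \<in> {d. d dvd n \<and> m dvd d \<and> mu (n div d) = -1}" by simp
    qed
  qed
  thus ?thesis by (rule bij_betw_same_card)
qed

section \<open>Product formulas over the divisors\<close>

lemma finite_divisors_of [simp]: "n > 0 \<Longrightarrow> finite (divisors_of n)"
  by (auto simp: divisors_of_def)

text \<open>The Moebius product formula with negative exponents cleared, so that it stays among
  polynomials. Root multiplicities are compared: at an element of order \<open>m\<close> dividing
  \<open>n\<close>, the factors of both signs balance by \<open>card_mu_balanced\<close> unless
  \<open>m = n\<close>.\<close>

lemma cyclotomic_times_prod:
  assumes "squarefree n"
  shows "cyclotomic n * (\<Prod>d | d \<in> divisors_of n \<and> mu (n div d) = -1. unity_poly d) =
    (\<Prod>d | d \<in> divisors_of n \<and> mu (n div d) = 1. unity_poly d)"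
    (is "cyclotomic n * prod _ ?M = prod _ ?P")
proof (rule monic_eq_if_proots_eq)
  have "n > 0" using assms by (auto intro: Nat.gr0I)
  have fin: "finite ?M" "finite ?P" using \<open>n > 0\<close> by simp_all
  have pos: "\<forall>d\<in>?M. d > 0" "\<forall>d\<in>?P. d > 0" by (auto simp: divisors_of_def)
  show "lead_coeff (prod unity_poly ?P) = 1"
    using pos(2) by (rule lead_coeff_prod_unity_poly)
  show "lead_coeff (cyclotomic n * prod unity_poly ?M) = 1"
    using lead_coeff_prod_unity_poly[OF pos(1)] lead_coeff_cyclotomic
    by (simp only: lead_coeff_mult mult_1)
  show "proots (cyclotomic n * prod unity_poly ?M) = proots (prod unity_poly ?P)"
  proof (rule multiset_eqI)
    fix z
    have *: "count (proots (cyclotomic n * prod unity_poly ?M)) z =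
        count (proots (cyclotomic n)) z + card {d\<in>?M. z ^ d = 1}"
      using cyclotomic_neq_0 prod_unity_poly_neq_0[OF pos(1)] count_proots_prod_unity_poly[OF fin(1) pos(1)]
      by (simp add: proots_mult del: count_proots)
    have **: "count (proots (prod unity_poly ?P)) z = card {d\<in>?P. z ^ d = 1}"
      using fin(2) pos(2) by (rule count_proots_prod_unity_poly)
    have "count (proots (cyclotomic n)) z + card {d\<in>?M. z ^ d = 1} = card {d\<in>?P. z ^ d = 1}"
    proof (cases "z ^ n = 1")
      case False
      \<comment> \<open>If \<open>z\<close> is not an n-th root of unity, it is a root of no factor
        on either side.\<close>
      have "z ^ d \<noteq> 1" if "d dvd n" for d
        using that False by (auto simp: power_mult)
      hence "{d\<in>?M. z ^ d = 1} = {}" "{d\<in>?P. z ^ d = 1} = {}" by (auto simp: divisors_of_def)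
      moreover have "count (proots (cyclotomic n)) z = 0"
      proof -
        have "poly (unity_poly n) z \<noteq> 0" using False by simp
        hence "poly (cyclotomic n) z \<noteq> 0"
          by (subst (asm) cyclotomic_times_inverse_cyclotomic[OF \<open>n > 0\<close>, symmetric]) auto
        thus ?thesis using cyclotomic_neq_0 by (simp add: order_0I)
      qed
      ultimately show ?thesis by (simp only: card.empty add_0)
    next
      case True
      then obtain m where m: "m > 0" "\<And>h. z ^ h = 1 \<longleftrightarrow> m dvd h"
        using power_eq_1_iff_dvd \<open>n > 0\<close> by metis
      have "m dvd n" using m True by simp
      have sets: "{d\<in>?M. z ^ d = 1} = {d. d dvd n \<and> m dvd d \<and> mu (n div d) = -1}"
        "{d\<in>?P. z ^ d = 1} = {d. d dvd n \<and> m dvd d \<and> mu (n div d) = 1}"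
        using m \<open>n > 0\<close> by (auto simp: divisors_of_def intro: Nat.gr0I)
      show ?thesis
      proof (cases "m = n")
        case True
        \<comment> \<open>Only \<open>d = n\<close> is left, with \<open>mu 1 = 1\<close>; it
          accounts for the simple root of the cyclotomic polynomial.\<close>
        hence "{d. d dvd n \<and> m dvd d \<and> mu (n div d) = -1} = {}"
          "{d. d dvd n \<and> m dvd d \<and> mu (n div d) = 1} = {n}"
          using \<open>n > 0\<close> by (auto dest: dvd_antisym)
        thus ?thesis unfolding sets using True count_proots_cyclotomic[OF \<open>n > 0\<close> m]
          by (simp only: card.empty) simp
      next
        case False
        with card_mu_balanced[OF assms \<open>m dvd n\<close>] count_proots_cyclotomic[OF \<open>n > 0\<close> m]
        show ?thesis unfolding sets by simp
      qed
    qed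
    with * ** show "count (proots (cyclotomic n * prod unity_poly ?M)) z = count (proots (prod unity_poly ?P)) z"
      by simp
  qed
qed

text \<open>The factor for \<open>d = n\<close> in \<open>cyclotomic_times_prod\<close> is x^n - 1,
  the product of both cyclotomic polynomials; the common factor \<open>cyclotomic n\<close> then
  cancels.\<close>

lemma inverse_cyclotomic_times_prod:
  assumes "squarefree n"
  shows "inverse_cyclotomic n * (\<Prod>d | d \<in> divisors_of n - {n} \<and> mu (n div d) = 1. unity_poly d) =
    (\<Prod>d | d \<in> divisors_of n - {n} \<and> mu (n div d) = -1. unity_poly d)"
proof -
  have "n > 0" using assms by (auto intro: Nat.gr0I)
  let ?P = "{d. d \<in> divisors_of n \<and> mu (n div d) = 1}"
  let ?P' = "{d. d \<in> divisors_of n - {n} \<and> mu (n div d) = 1}"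
  let ?M = "{d. d \<in> divisors_of n \<and> mu (n div d) = -1}"
  have M: "{d. d \<in> divisors_of n - {n} \<and> mu (n div d) = -1} = ?M"
    using \<open>n > 0\<close> by auto
  have "?P = insert n ?P'" using \<open>n > 0\<close> by (auto simp: divisors_of_def)
  moreover have "finite ?P'" using \<open>n > 0\<close> by simp
  ultimately have "prod unity_poly ?P = unity_poly n * prod unity_poly ?P'"
    by simp
  hence "cyclotomic n * prod unity_poly ?M = cyclotomic n * (inverse_cyclotomic n * prod unity_poly ?P')"
    using cyclotomic_times_prod[OF assms] cyclotomic_times_inverse_cyclotomic[OF \<open>n > 0\<close>]
    by (simp add: mult.assoc)
  thus ?thesis using cyclotomic_neq_0 M by simp
qed

section \<open>The gap bound for one partition\<close>

text \<open>An arbitrary sign function \<open>e\<close> lets one argument serve both bounds: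
  \<open>F\<close> is the product of the (x^d - 1)^(e d). Assumption \<open>B\<close> compares root
  multiplicities at elements of order \<open>m\<close>.\<close>

lemma max_gap_ge_of_partition:
  fixes e :: "nat \<Rightarrow> int"
  assumes fin: "finite A" "finite B" and disj: "A \<inter> B = {}" and "A \<noteq> {}"
    and pos: "\<forall>d\<in>A \<union> B. d > 0" and e: "\<forall>d\<in>A \<union> B. e d = 1 \<or> e d = -1"
    and F: "F * (\<Prod>d | d \<in> A \<union> B \<and> e d = -1. unity_poly d) = (\<Prod>d | d \<in> A \<union> B \<and> e d = 1. unity_poly d)"
    and B: "\<And>m. m > 0 \<Longrightarrow> card {d\<in>B. e d = -1 \<and> m dvd d} \<le> card {d\<in>B. e d = 1 \<and> m dvd d}"
  shows "int (Min A) - (\<Sum>d\<in>B. e d * int d) \<le> int (max_gap F)"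
proof -
  define Q where "Q S s = (\<Prod>d | d \<in> S \<and> e d = s. unity_poly d)" for S s
  have Q0: "Q S s \<noteq> 0" if "S \<subseteq> A \<union> B" for S s
    unfolding Q_def using that pos by (intro prod_unity_poly_neq_0) auto
  have split: "Q (A \<union> B) s = Q A s * Q B s" for s
    unfolding Q_def using fin disj by (subst prod.union_disjoint[symmetric]) (auto intro!: prod.cong)
  have cnt: "count (proots (Q S s)) z = card {d\<in>S. e d = s \<and> z ^ d = 1}" if "S \<subseteq> A \<union> B" for S s z
    unfolding Q_def using that pos fin
    by (subst count_proots_prod_unity_poly) (auto intro: finite_subset simp: conj_assoc)
  have "Q B (-1) dvd Q B 1"
  proof (rule dvd_if_proots_subset)
    show "proots (Q B (-1)) \<subseteq># proots (Q B 1)"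
      unfolding subseteq_mset_def
    proof
      fix z
      show "count (proots (Q B (-1))) z \<le> count (proots (Q B 1)) z"
      proof (cases "\<exists>d>0. z ^ d = 1")
        case True
        then obtain m where "m > 0" "\<And>h. z ^ h = 1 \<longleftrightarrow> m dvd h" using power_eq_1_iff_dvd by metis
        thus ?thesis using B by (simp add: cnt del: count_proots)
      next
        case False
        \<comment> \<open>A \<open>z\<close> of infinite order is a root of no factor.\<close>
        hence "{d \<in> B. e d = - 1 \<and> z ^ d = 1} = {}" using pos by blast
        thus ?thesis by (simp only: cnt Un_upper2 card.empty)
      qed
    qed
  qed (use Q0 in simp)
  then obtain G where G: "Q B 1 = Q B (-1) * G" by auto
  have "G \<noteq> 0" using G Q0[of B 1] by auto
  have eq: "F * Q A (-1) = Q A 1 * G"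
  proof -
    have "Q B (-1) * (F * Q A (-1)) = Q B (-1) * (Q A 1 * G)"
      using F unfolding Q_def[symmetric] split G by (simp add: mult_ac)
    thus ?thesis using Q0[of B "-1"] by simp
  qed
  have "degree (Q B 1) = degree (Q B (-1)) + degree G"
    using G Q0[of B "-1"] \<open>G \<noteq> 0\<close> by (simp add: degree_mult_eq)
  hence deg: "\<Sum>{d\<in>B. e d = 1} = \<Sum>{d\<in>B. e d = -1} + degree G"
    unfolding Q_def using pos by (simp add: degree_prod_unity_poly)
  have "(\<Sum>d\<in>B. e d * int d) = (\<Sum>d | d \<in> B \<and> e d = 1. e d * int d) + (\<Sum>d | d \<in> B \<and> e d = -1. e d * int d)"
    using fin e by (subst sum.union_disjoint[symmetric]) (auto intro!: sum.cong)
  also have "\<dots> = int (\<Sum>{d\<in>B. e d = 1}) - int (\<Sum>{d\<in>B. e d = -1})"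
    by (simp add: sum_negf)
  finally have degG: "(\<Sum>d\<in>B. e d * int d) = int (degree G)" using deg by simp
  define a where "a = Min A"
  \<comment> \<open>The signs to which \<open>Q A (-1)\<close> and \<open>Q A 1\<close> reduce
    modulo x^a. Then \<open>eq\<close> gives u F = v G modulo x^a.\<close>
  define u v where "u = (-1 :: complex) ^ card {d\<in>A. e d = -1}" and "v = (-1 :: complex) ^ card {d\<in>A. e d = 1}"
  have uv: "u * u = 1" "u \<noteq> 0" "v \<noteq> 0" by (auto simp: u_def v_def simp flip: power_add mult_2)
  have "monom 1 a dvd Q A (-1) - [:u:]" "monom 1 a dvd Q A 1 - [:v:]"
    unfolding Q_def u_def v_def using fin by (intro prod_unity_poly_cong; simp add: a_def)+
  hence "monom 1 a dvd (Q A 1 - [:v:]) * G - F * (Q A (-1) - [:u:])"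
    by (rule dvd_diff[OF dvd_mult2 dvd_mult, rotated])
  also have "(Q A 1 - [:v:]) * G - F * (Q A (-1) - [:u:]) = smult u F - smult v G"
    using eq by (simp add: algebra_simps)
  finally have dvd: "monom 1 a dvd smult u F - smult v G" .
  have "a - degree G \<le> max_gap F"
  proof (rule max_gap_ge_of_agree_below)
    show "u * v \<noteq> 0" using uv by simp
    show "G \<noteq> 0" by fact
    show "coeff F i = u * v * coeff G i" if "i < a" for i
    proof -
      have "u * coeff F i = v * coeff G i" using dvd that by (simp add: monom_1_dvd_iff')
      \<comment> \<open>The sign \<open>u\<close> is its own inverse, so multiplying by it solves
        for the coefficient of \<open>F\<close>.\<close>
      hence "u * u * coeff F i = u * v * coeff G i" by (simp add: mult.assoc)
      thus ?thesis by (simp add: uv)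
    qed
    show "F \<noteq> smult (u * v) G"
    proof
      assume "F = smult (u * v) G"
      \<comment> \<open>Equality would make the factors of \<open>A\<close> with sign -1 and those
        with sign 1 have the same roots with multiplicity.\<close>
      hence "G * smult (u * v) (Q A (-1)) = G * Q A 1" using eq by (simp add: mult.commute)
      hence "smult (u * v) (Q A (-1)) = Q A 1" using \<open>G \<noteq> 0\<close> by (simp only: mult_cancel_left) simp
      hence roots: "proots (Q A (-1)) = proots (Q A 1)" using uv by (metis proots_smult no_zero_divisors)
      \<comment> \<open>a primitive root of unity of order \<^term>\<open>Max A\<close> is a root of exactly one factor\<close>
      define M where "M = Max A"
      have M: "M \<in> A" "M > 0" "d \<in> A \<Longrightarrow> d \<le> M" for d
        using fin \<open>A \<noteq> {}\<close> pos by (auto simp: M_def)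
      have prim: "root_of_unity M 1 ^ d = 1 \<longleftrightarrow> d = M" if "d \<in> A" for d
        using that M pos by (auto simp: root_of_unity_power_eq_1_iff dest: dvd_imp_le intro: antisym)
      have "card {d\<in>A. e d = s \<and> root_of_unity M 1 ^ d = 1} = (if e M = s then 1 else 0)" for s
      proof -
        have "{d\<in>A. e d = s \<and> root_of_unity M 1 ^ d = 1} = (if e M = s then {M} else {})"
          using prim M(1) by auto
        thus ?thesis by simp
      qed
      hence "count (proots (Q A s)) (root_of_unity M 1) = (if e M = s then 1 else 0)" for s
        by (simp only: cnt Un_upper1)
      from this[of 1] this[of "-1"] show False using roots e M by (auto simp del: count_proots split: if_splits)
    qed
  qed
  \<comment> \<open>The truncated difference is at least the integer one, so the bound also covers a
    negative left-hand side.\<close>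
  thus ?thesis using degG by (simp add: a_def)
qed

section \<open>The conditions on B and the maxima over partitions\<close>

text \<open>Extends the stated condition from the divisor closure to every possible order
  \<open>m\<close> of a root: outside the closure, no element of \<open>B\<close> is a multiple of
  \<open>m\<close>.\<close>

lemma card_le_if_closure_condition:
  assumes "finite B" "\<forall>d\<in>divisor_closure B. card (S \<inter> multiples_of d) \<le> card (T \<inter> multiples_of d)"
    "S \<subseteq> B" "\<forall>d\<in>B. d > 0" "m > 0"
  shows "card (S \<inter> multiples_of m) \<le> card (T \<inter> multiples_of m)"
proof (cases "m \<in> divisor_closure B")
  case False
  hence "S \<inter> multiples_of m = {}"
    using assms by (auto simp: divisor_closure_def divisors_of_def multiples_of_def)
  thus ?thesis by simp
qed (use assms in auto)

lemma finite_partition_values: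
  assumes "finite S"
  shows "finite {f A B :: 'b | A B. A \<union> B = S \<and> A \<inter> B = {} \<and> A \<noteq> {} \<and> C B}"
  by (rule finite_subset[of _ "(\<lambda>(A, B). f A B) ` (Pow S \<times> Pow S)"]) (use assms in auto)

lemma partition_values_nonempty:
  assumes "S \<noteq> {}" "C {}"
  shows "{f A B | A B. A \<union> B = S \<and> A \<inter> B = {} \<and> A \<noteq> {} \<and> C B} \<noteq> {}"
proof -
  \<comment> \<open>The partition with empty \<open>B\<close> is always admissible.\<close>
  have "f S {} \<in> {f A B | A B. A \<union> B = S \<and> A \<inter> B = {} \<and> A \<noteq> {} \<and> C B}"
    unfolding mem_Collect_eq by (intro exI[of _ S] exI[of _ "{}"]) (use assms in auto)
  thus ?thesis by blast
qed

section \<open>The two bounds for squarefree n > 1\<close>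

context
  fixes n :: nat
  assumes sf: "squarefree n" and n_gt_1: "n > 1"
begin

lemma proper_divisors_nonempty: "divisors_of n - {n} \<noteq> {}"
proof -
  have "1 \<in> divisors_of n - {n}" using n_gt_1 by (auto simp: divisors_of_def)
  thus ?thesis by blast
qed

lemma mu_cofactor_cases:
  assumes "d \<in> divisors_of n"
  shows "mu (n div d) = 1 \<or> mu (n div d) = -1"
proof (rule mu_cases)
  from assms obtain c where "n = d * c" "d > 0" by (auto simp: divisors_of_def)
  thus "squarefree (n div d)" using sf squarefree_multD(2)[of d c] by simp
qed

text \<open>The product formula for the cyclotomic polynomial also involves \<open>d = n\<close>,
  which the partitions omit. Adding \<open>n\<close> to \<open>A\<close> repairs this without
  changing the minimum, as \<open>A\<close> is a nonempty set of divisors of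
  \<open>n\<close>.\<close>

lemma eps_plus_le_max_gap: "eps_plus n \<le> int (max_gap (cyclotomic n))"
  unfolding eps_plus_def
proof (rule Max.boundedI)
  let ?V = "{int (Min A) - (\<Sum>d\<in>B. mu (n div d) * int d) | A B.
            A \<union> B = divisors_of n - {n} \<and> A \<inter> B = {} \<and> A \<noteq> {} \<and> cond_plus n B}"
  show "finite ?V" using n_gt_1 by (intro finite_partition_values) simp
  have "cond_plus n {}" by (simp add: cond_plus_def divisor_closure_def)
  with proper_divisors_nonempty show "?V \<noteq> {}" by (rule partition_values_nonempty)
  fix x assume "x \<in> ?V"
  then obtain A B where x: "x = int (Min A) - (\<Sum>d\<in>B. mu (n div d) * int d)"
    and AB: "A \<union> B = divisors_of n - {n}" "A \<inter> B = {}" "A \<noteq> {}" and C: "cond_plus n B"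
    by blast
  have "finite (A \<union> B)" unfolding AB using n_gt_1 by simp
  hence fin: "finite A" "finite B" by auto
  have nB: "n \<notin> B" "n \<notin> A" using AB by auto
  have "n \<in> divisors_of n" using n_gt_1 by (simp add: divisors_of_def)
  with AB(1) have union: "insert n A \<union> B = divisors_of n" by blast
  have pos: "\<forall>d\<in>insert n A \<union> B. d > 0" unfolding union by (auto simp: divisors_of_def)
  have "Min (insert n A) = Min A"
  proof -
    have "Min A \<in> divisors_of n" using fin AB(3) union by (metis Min_in UnI1 insertCI)
    hence "Min A \<le> n" using n_gt_1 by (auto simp: divisors_of_def dest: dvd_imp_le)
    thus ?thesis using fin AB by simp
  qed
  moreover have "int (Min (insert n A)) - (\<Sum>d\<in>B. mu (n div d) * int d) \<le> int (max_gap (cyclotomic n))"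
  proof (rule max_gap_ge_of_partition)
    fix m :: nat assume "m > 0"
    have "card (minus_part n B \<inter> multiples_of m) \<le> card (plus_part n B \<inter> multiples_of m)"
      by (rule card_le_if_closure_condition[OF fin(2)])
         (use C pos \<open>m > 0\<close> in \<open>auto simp: cond_plus_def minus_part_def\<close>)
    moreover have "minus_part n B \<inter> multiples_of m = {d\<in>B. mu (n div d) = -1 \<and> m dvd d}"
      "plus_part n B \<inter> multiples_of m = {d\<in>B. mu (n div d) = 1 \<and> m dvd d}"
      using pos by (auto simp: minus_part_def plus_part_def multiples_of_def)
    ultimately show "card {d\<in>B. mu (n div d) = -1 \<and> m dvd d} \<le> card {d\<in>B. mu (n div d) = 1 \<and> m dvd d}"
      by simp
  next
    show "\<forall>d\<in>insert n A \<union> B. mu (n div d) = 1 \<or> mu (n div d) = -1"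
      unfolding union using mu_cofactor_cases by blast
  qed (use fin AB nB pos cyclotomic_times_prod[OF sf] in \<open>simp_all only: union\<close>, auto)
  ultimately show "x \<le> int (max_gap (cyclotomic n))" using x by simp
qed

text \<open>The same bound with the sign function negated. The product formula here runs over proper
  divisors only, so the partition is used as it is.\<close>

lemma eps_minus_le_max_gap: "eps_minus n \<le> int (max_gap (inverse_cyclotomic n))"
  unfolding eps_minus_def
proof (rule Max.boundedI)
  let ?V = "{int (Min A) + (\<Sum>d\<in>B. mu (n div d) * int d) | A B.
            A \<union> B = divisors_of n - {n} \<and> A \<inter> B = {} \<and> A \<noteq> {} \<and> cond_minus n B}"
  show "finite ?V" using n_gt_1 by (intro finite_partition_values) simp
  have "cond_minus n {}" by (simp add: cond_minus_def divisor_closure_def)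
  with proper_divisors_nonempty show "?V \<noteq> {}" by (rule partition_values_nonempty)
  fix x assume "x \<in> ?V"
  then obtain A B where x: "x = int (Min A) + (\<Sum>d\<in>B. mu (n div d) * int d)"
    and AB: "A \<union> B = divisors_of n - {n}" "A \<inter> B = {}" "A \<noteq> {}" and C: "cond_minus n B"
    by blast
  have "finite (A \<union> B)" unfolding AB using n_gt_1 by simp
  hence fin: "finite A" "finite B" by auto
  have pos: "\<forall>d\<in>A \<union> B. d > 0" unfolding AB by (auto simp: divisors_of_def)
  have neg: "- mu (n div d) = 1 \<longleftrightarrow> mu (n div d) = -1" "- mu (n div d) = -1 \<longleftrightarrow> mu (n div d) = 1" for d
    by auto
  have "int (Min A) - (\<Sum>d\<in>B. - mu (n div d) * int d) \<le> int (max_gap (inverse_cyclotomic n))"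
  \<comment> \<open>Rewriting with \<open>neg\<close> turns the conditions on the negated sign into
    those on \<open>mu\<close> that the product formula and \<open>cond_minus\<close> use.\<close>
  proof (rule max_gap_ge_of_partition, unfold neg)
    fix m :: nat assume "m > 0"
    have "card (plus_part n B \<inter> multiples_of m) \<le> card (minus_part n B \<inter> multiples_of m)"
      by (rule card_le_if_closure_condition[OF fin(2)])
         (use C pos \<open>m > 0\<close> in \<open>auto simp: cond_minus_def plus_part_def\<close>)
    moreover have "minus_part n B \<inter> multiples_of m = {d\<in>B. mu (n div d) = -1 \<and> m dvd d}"
      "plus_part n B \<inter> multiples_of m = {d\<in>B. mu (n div d) = 1 \<and> m dvd d}"
      using pos by (auto simp: minus_part_def plus_part_def multiples_of_def)
    ultimately show "card {d\<in>B. mu (n div d) = 1 \<and> m dvd d} \<le> card {d\<in>B. mu (n div d) = -1 \<and> m dvd d}"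
      by simp
  next
    show "\<forall>d\<in>A \<union> B. mu (n div d) = -1 \<or> mu (n div d) = 1"
      unfolding AB using mu_cofactor_cases by blast
  qed (use fin AB pos inverse_cyclotomic_times_prod[OF sf] in \<open>simp_all only: AB\<close>)
  thus "x \<le> int (max_gap (inverse_cyclotomic n))" using x by (simp add: sum_negf)
qed

end

section \<open>Products of distinct odd primes\<close>

theorem theorem5:
  fixes k n :: nat and p :: "nat \<Rightarrow> nat"
  assumes "k \<ge> 1"
    and "\<And>i. i \<in> {1..k} \<Longrightarrow> prime (p i) \<and> odd (p i)"
    and "strict_mono_on {1..k} p"
    and "n = (\<Prod>i=1..k. p i)"
  shows "int (max_gap (cyclotomic n)) \<ge> eps_plus n \<and>
         int (max_gap (inverse_cyclotomic n)) \<ge> eps_minus n"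
proof -
  have "squarefree n"
    unfolding assms(4)
  proof (rule squarefree_prod_coprime)
    fix i j assume "i \<in> {1..k}" "j \<in> {1..k}" "i \<noteq> j"
    thus "coprime (p i) (p j)"
      \<comment> \<open>Strict monotonicity makes the primes distinct, hence pairwise
        coprime.\<close>
      using assms(2) strict_mono_on_imp_inj_on[OF assms(3)]
      by (intro primes_coprime) (auto dest: inj_onD)
  qed (use assms(2) squarefree_prime in blast)
  \<comment> \<open>This makes 1 a proper divisor, so the maxima range over nonempty sets.\<close>
  moreover have "n > 1"
  proof -
    have "p 1 dvd n" unfolding assms(4) using assms(1) by (intro dvd_prodI) auto
    moreover have "p 1 > 1" using assms(1) assms(2)[of 1] by (simp add: prime_gt_Suc_0_nat)
    moreover have "n > 0" unfolding assms(4) using assms(2) by (simp add: prod_pos prime_gt_0_nat)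
    ultimately show ?thesis using dvd_imp_le[of "p 1" n] by linarith
  qed
  ultimately show ?thesis using eps_plus_le_max_gap eps_minus_le_max_gap by blast
qed

end
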